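(* Let $q=2^m$, where $m$ is a positive integer, and let $a,b\in\mathbb{F}_q^*$. Then $$f_2(X)=aX^{1+q}+bX^{1+q^2}+X^{2q^2+2q}$$ is a permutation polynomial over $\mathbb{F}_{q^3}$ if and only if $b=a$.
   Context: A polynomial $f\in\mathbb{F}_{Q}[X]$ is a permutation polynomial over $\mathbb{F}_Q$ if $c\mapsto f(c)$ is a bijection of $\mathbb{F}_Q$. *)

theory Defs
  imports "HOL-Computational_Algebra.Computational_Algebra"
begin

text \<open>
  Finite fields are types of class \<open>finite_field\<close>; the field with \<open>Q\<close> elements is
  such a type whose universe has cardinality \<open>Q\<close>.
\<close>

definition is_subfield :: "'a::field set \<Rightarrow> bool" where
  "is_subfield K \<longleftrightarrow>
     0 \<in> K \<and> 1 \<in> K \<and>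
     (\<forall>x\<in>K. \<forall>y\<in>K. x + y \<in> K) \<and> (\<forall>x\<in>K. - x \<in> K) \<and>
     (\<forall>x\<in>K. \<forall>y\<in>K. x * y \<in> K) \<and> (\<forall>x\<in>K. x \<noteq> 0 \<longrightarrow> inverse x \<in> K)"

definition permutation_polynomial :: "'a::finite_field poly \<Rightarrow> bool" where
  "permutation_polynomial f \<longleftrightarrow> bij (\<lambda>c. poly f c)"

definition f2 :: "nat \<Rightarrow> 'a::field \<Rightarrow> 'a \<Rightarrow> 'a poly" where
  "f2 q a b = monom a (1 + q) + monom b (1 + q^2) + monom 1 (2 * q^2 + 2 * q)"

end

theory Submission
  imports Defs
begin

text \<open>
  Put \<open>w = c\<^bsup>q + q\<^sup>2\<^esup>\<close>. For \<open>c\<close> in the field with \<open>q\<^sup>3\<close> elements one has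
  \<open>f\<^sub>2(c) = L(w)\<close> with the additive map \<open>L(w) = w\<^sup>2 + a w\<^bsup>q\<^sup>2\<^esup> + b w\<^bsup>q\<^esup>\<close>, and \<open>c \<mapsto> w\<close> is
  injective because \<open>w\<close> determines the square of the norm of \<open>c\<close>, hence, in characteristic 2,
  the norm and then \<open>c\<close>. If \<open>a = b\<close> and \<open>L(w) = 0\<close>, taking traces shows that \<open>w\<close> has trace 0,
  so \<open>w\<^sup>2 = a w\<close>, and \<open>w = a\<close> is excluded because \<open>a\<close> has trace \<open>3 a = a\<close>. If \<open>a \<noteq> b\<close>, the square
  root of \<open>a + b\<close> is a nonzero root of \<open>f\<^sub>2\<close> in the subfield with \<open>q\<close> elements.
\<close>

text \<open>Multiplication by a nonzero \<open>x\<close> permutes \<open>K - {0}\<close>; comparing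
  the products over this set gives \<open>x ^ card S = 1\<close>.\<close>

lemma subfield_power_card:
  fixes K :: "'a::field set"
  assumes "is_subfield K" "finite K" "x \<in> K"
  shows "x ^ card K = x"
proof (cases "x = 0")
  case True
  have "card K > 0" using assms by (auto simp: card_gt_0_iff)
  with True show ?thesis by simp
next
  case False
  define S where "S = K - {0}"
  have fin: "finite S" using assms by (simp add: S_def)
  have inj: "inj_on ((*) x) S" using False by (auto simp: inj_on_def)
  have "(*) x ` S \<subseteq> S" using assms False by (auto simp: S_def is_subfield_def)
  then have "(*) x ` S = S" using fin inj by (simp add: endo_inj_surj)
  then have "\<Prod>S = (\<Prod>y\<in>S. x * y)"
    using prod.reindex[OF inj, of "\<lambda>y. y"] by simp
  also have "\<dots> = x ^ card S * \<Prod>S" by (simp add: prod.distrib)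
  finally have "x ^ card S = 1" using fin by (auto simp: S_def)
  moreover have "card K = Suc (card S)"
    unfolding S_def using assms by (intro card.remove) (auto simp: is_subfield_def)
  ultimately show ?thesis by simp
qed

text \<open>Raising -1 to the power of the cardinality fixes it, but that exponent is even, so -1 =
  1.\<close>

lemma CHAR_eq_2_if_card_power_2:
  assumes "card (UNIV :: 'a::finite_field set) = 2 ^ k"
  shows "CHAR('a) = 2"
proof -
  have "k \<noteq> 0"
  proof
    assume "k = 0"
    with assms have "card (UNIV :: 'a set) = 1" by simp
    then show False by (metis UNIV_I card_1_singletonE singletonD zero_neq_one)
  qed
  then have "(-1 :: 'a) ^ (2 ^ k) = 1" by simp
  then have "of_nat 2 = (0 :: 'a)"
    using finite_field_power_card_eq_same[of "-1 :: 'a"] assms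
    by (simp add: add_eq_0_iff)
  then have "CHAR('a) dvd 2" by (simp only: of_nat_eq_0_iff_char_dvd)
  moreover have "prime CHAR('a)" by simp
  ultimately show ?thesis by (simp add: primes_dvd_imp_eq)
qed

lemma power2_inj_CHAR_2:
  fixes x y :: "'a::idom"
  assumes "CHAR('a) = 2" "x\<^sup>2 = y\<^sup>2"
  shows "x = y"
  using assms uminus_CHAR_2[of y] by (auto simp: power2_eq_iff)

theorem theorem3p2:
  fixes m q :: nat and Fq :: "'a::finite_field set" and a b :: 'a
  assumes "m > 0" and "q = 2 ^ m"
    and "card (UNIV :: 'a set) = q ^ 3"
    and "is_subfield Fq" and "card Fq = q"
    and "a \<in> Fq - {0}" and "b \<in> Fq - {0}"
  shows "permutation_polynomial (f2 q a b) \<longleftrightarrow> b = a"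
proof -
  \<comment> \<open>The Frobenius map over \<open>Fq\<close>: a ring endomorphism that fixes
    \<open>Fq\<close> pointwise and whose third iterate is the identity.\<close>
  define F where "F = (\<lambda>x::'a. x ^ q)"
  have char: "CHAR('a) = 2"
    using assms CHAR_eq_2_if_card_power_2[where ?'a = 'a, of "m * 3"] by (simp add: power_mult)
  have F_add: "F (x + y) = F x + F y" for x y
    using freshmans_dream'[where ?'a = 'a, of q m x y] assms(2) char by (simp add: F_def)
  have F_mult: "F (x * y) = F x * F y" for x y
    by (simp add: F_def power_mult_distrib)
  have F_power: "F (x ^ n) = F x ^ n" for x n
    by (simp add: F_def flip: power_mult add: mult.commute)
  have F3: "F (F (F x)) = x" for x
    using finite_field_power_card_eq_same[of x] assms(3)
    by (simp add: F_def power3_eq_cube flip: power_mult)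
  have F_fix: "F x = x" if "x \<in> Fq" for x
    using subfield_power_card[OF assms(4) finite that] assms(5) by (simp add: F_def)
  have F_0: "F 0 = 0" using assms by (simp add: F_def)
  have uminus: "- x = x" for x :: 'a using char by (rule uminus_CHAR_2)
  \<comment> \<open>Once \<open>algebra_simps\<close> has sorted a sum, equal terms stand side by
    side; \<open>dbl\<close> and \<open>dbl'\<close> cancel them in pairs.\<close>
  have dbl: "x + x = 0" for x :: 'a using uminus[of x] by (simp add: add_eq_0_iff)
  have dbl': "x + (x + y) = y" for x y :: 'a by (simp add: dbl flip: add.assoc)
  have poly: "poly (f2 q a b) c = (F c * F (F c))\<^sup>2 + a * (c * F c) + b * (c * F (F c))" for c
    by (simp add: f2_def F_def poly_monom power_add power_mult_distrib power2_eq_square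
        flip: power_mult)
      (simp add: algebra_simps mult_2_right flip: power_add)
  show ?thesis
  proof
    assume perm: "permutation_polynomial (f2 q a b)"
    show "b = a"
    proof (rule ccontr)
      assume "b \<noteq> a"
      define d where "d = a + b"
      have d_Fq: "d \<in> Fq" using assms by (auto simp: d_def is_subfield_def)
      have d_0: "d \<noteq> 0" using \<open>b \<noteq> a\<close> uminus[of b] by (auto simp: d_def add_eq_0_iff)
      \<comment> \<open>As \<open>d ^ (2 ^ m) = d\<close> and \<open>m > 0\<close>, halving the
        exponent yields a square root of \<open>d\<close>.\<close>
      define c where "c = d ^ (2 ^ (m - 1))"
      have c2: "c\<^sup>2 = d"
        using F_fix[OF d_Fq] assms by (simp add: c_def F_def flip: power_mult power_Suc2)
      have "F c = c" using F_fix[OF d_Fq] by (simp add: c_def F_power)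
      then have "poly (f2 q a b) c = c\<^sup>2 * (c\<^sup>2 + d)"
        by (simp add: poly d_def power2_eq_square algebra_simps)
      also have "\<dots> = poly (f2 q a b) 0" by (simp add: c2 dbl poly F_0)
      finally have "c = 0" using perm by (auto simp: permutation_polynomial_def bij_def inj_def)
      with c2 d_0 show False by simp
    qed
  next
    assume ba: "b = a"
    have Fa: "F a = a" and a_0: "a \<noteq> 0" using F_fix assms by auto
    define L where "L = (\<lambda>w. w\<^sup>2 + a * F (F w) + a * F w)"
    have poly_L: "poly (f2 q a b) c = L (F c * F (F c))" for c
      unfolding poly by (simp add: L_def F_mult F3 ba algebra_simps)
    have ker: "w = 0" if "L w = 0" for w
    proof -
      let ?T = "w + F w + F (F w)"
      have e: "w\<^sup>2 + a * F (F w) + a * F w = 0" using that by (simp add: L_def)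
      from arg_cong[OF e, of F] have e1: "(F w)\<^sup>2 + a * w + a * F (F w) = 0"
        by (simp add: F_add F_mult F_power F3 Fa F_0)
      from arg_cong[OF e1, of F] have e2: "(F (F w))\<^sup>2 + a * F w + a * w = 0"
        by (simp add: F_add F_mult F_power F3 Fa F_0)
      \<comment> \<open>In the sum of the three conjugate equations every term with factor
        \<open>a\<close> occurs twice and cancels; the squares remain.\<close>
      have "?T\<^sup>2 = (w\<^sup>2 + a * F (F w) + a * F w) + ((F w)\<^sup>2 + a * w + a * F (F w))
          + ((F (F w))\<^sup>2 + a * F w + a * w)"
        by (simp add: power2_eq_square algebra_simps dbl dbl')
      then have T: "?T = 0" by (simp add: e e1 e2)
      then have "F w + F (F w) = w"
        using uminus[of w] by (simp add: add.assoc add_eq_0_iff)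
      then have "a * F (F w) + a * F w = a * w" by (metis add.commute distrib_left)
      then have "w * (w + a) = 0"
        using e by (simp add: power2_eq_square algebra_simps)
      then consider "w = 0" | "w = a" using uminus[of a] by (auto simp: add_eq_0_iff2)
      then show ?thesis
      proof cases
        case 2
        with T Fa a_0 show ?thesis by (simp add: dbl)
      qed
    qed
    have "inj (\<lambda>c. poly (f2 q a b) c)"
    proof (rule injI)
      fix x y
      let ?v = "F x * F (F x)" and ?w = "F y * F (F y)"
      assume "poly (f2 q a b) x = poly (f2 q a b) y"
      then have "L ?v + L ?w = 0" by (simp add: poly_L dbl)
      moreover have "L (v + w) = L v + L w" for v w
        by (simp add: L_def F_add power2_eq_square algebra_simps dbl dbl')
      ultimately have "?v + ?w = 0" using ker by simp
      then have vw: "?v = ?w" using uminus[of ?w] by (simp add: add_eq_0_iff2)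
      from arg_cong[OF vw, of F] have vw1: "F (F x) * x = F (F y) * y"
        by (simp add: F_mult F3)
      from arg_cong[OF vw1, of F] have vw2: "x * F x = y * F y"
        by (simp add: F_mult F3)
      \<comment> \<open>\<open>x * ?v\<close> is the norm of \<open>x\<close>; each conjugate of
        \<open>x\<close> divides exactly two of the three displayed factors on the right.\<close>
      have "(x * ?v)\<^sup>2 = ?v * (F (F x) * x) * (x * F x)"
        by (simp add: power2_eq_square algebra_simps)
      also have "\<dots> = (y * ?w)\<^sup>2"
        unfolding vw vw1 vw2 by (simp add: power2_eq_square algebra_simps)
      finally have norm: "x * ?v = y * ?w" by (rule power2_inj_CHAR_2[OF char])
      have F_eq_0: "F z = 0 \<longleftrightarrow> z = 0" for z using assms by (simp add: F_def)
      show "x = y"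
      \<comment> \<open>If \<open>?v = 0\<close>, then \<open>x\<close> and \<open>y\<close> are
        both 0; otherwise \<open>?v\<close> cancels from \<open>norm\<close>.\<close>
      proof (cases "?v = 0")
        case True
        with vw show ?thesis by (simp add: F_eq_0)
      next
        case False
        with norm vw show ?thesis by simp
      qed
    qed
    then show "permutation_polynomial (f2 q a b)"
      by (simp add: permutation_polynomial_def bij_def finite_UNIV_inj_surj)
  qed
qed

end
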